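(* A function $f: \mathbb{Z}^2 \to \mathbb{R} \cup \{+\infty\}$ (with $\operatorname{dom} f \neq \emptyset$) is integrally convex if and only if $\operatorname{dom} f$ is an integrally convex set and, for every $z \in \operatorname{dom} f$, the five inequalities $$g(0,0)+g(2,1) \ge g(1,1)+g(1,0),\quad g(0,0)+g(2,-1) \ge g(1,-1)+g(1,0),\quad g(0,0)+g(2,0) \ge 2g(1,0),$$ $$g(0,0)+g(2,2) \ge 2g(1,1),\quad g(0,0)+g(2,-2) \ge 2g(1,-1)$$ are satisfied both by $g(x_1,x_2) = f_z(x_1,x_2)$ and by $g(x_1,x_2) = f_z(x_2,x_1)$, where $f_z(x) := f(z+x)$.
   Context: $\operatorname{dom} f = \{x \in \mathbb{Z}^n \mid f(x) < +\infty\}$. For $T \subseteq \mathbb{R}^n$, $\overline{T}$ denotes its convex hull. For $x \in \mathbb{R}^n$, $N(x) = \{ z \in \mathbb{Z}^n \mid |x_i - z_i| < 1 \ (i=1,\dots,n)\}$. A nonempty set $S \subseteq \mathbb{Z}^n$ is integrally convex if every $x \in \overline{S}$ satisfies $x \in \overline{S \cap N(x)}$. The local convex extension of $f$ is $\tilde f(x) = \min\{ \sum_{y \in N(x)} \lambda_y f(y) \mid \sum_{y \in N(x)} \lambda_y y = x,\ \sum \lambda_y = 1,\ \lambda_y \ge 0\}$ for $x \in \mathbb{R}^n$, and $f$ is integrally convex if $\tilde f$ is convex on $\mathbb{R}^n$. Inequalities involving $+\infty$ are read in the extended reals. *)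

theory Defs
  imports "HOL-Analysis.Analysis"
begin

definition rvec :: "int ^ 'n \<Rightarrow> real ^ 'n" where
  "rvec z = (\<chi> i. real_of_int (z $ i))"

definition effdom :: "(int ^ 'n \<Rightarrow> ereal) \<Rightarrow> (int ^ 'n) set" where
  "effdom f = {x. f x < \<infinity>}"

definition int_nbhd :: "real ^ 'n \<Rightarrow> (int ^ 'n) set" where
  "int_nbhd x = {z. \<forall>i. \<bar>x $ i - real_of_int (z $ i)\<bar> < 1}"

definition integrally_convex_set :: "(int ^ 'n) set \<Rightarrow> bool" where
  "integrally_convex_set S \<longleftrightarrow>
     S \<noteq> {} \<and>
     (\<forall>x \<in> convex hull (rvec ` S). x \<in> convex hull (rvec ` (S \<inter> int_nbhd x)))"

text \<open>
  The feasible set is a nonempty polytope and \<open>0 * \<infinity> = 0\<close> in \<^typ>\<open>ereal\<close>, so for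
  \<open>f\<close> without the value \<open>-\<infinity>\<close> the infimum below is attained, i.e. it is the minimum.
\<close>
definition local_convex_ext :: "(int ^ 'n \<Rightarrow> ereal) \<Rightarrow> real ^ 'n \<Rightarrow> ereal" where
  "local_convex_ext f x =
     Inf {(\<Sum>y\<in>int_nbhd x. ereal (l y) * f y) | l :: int ^ 'n \<Rightarrow> real.
            (\<Sum>y\<in>int_nbhd x. l y *\<^sub>R rvec y) = x \<and>
            (\<Sum>y\<in>int_nbhd x. l y) = 1 \<and>
            (\<forall>y\<in>int_nbhd x. 0 \<le> l y)}"

text \<open>Convexity of an extended-real-valued function; meant for functions without the value
  \<open>-\<infinity>\<close>.\<close>
definition ereal_convex :: "('a::real_vector \<Rightarrow> ereal) \<Rightarrow> bool" where
  "ereal_convex g \<longleftrightarrow>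
     (\<forall>x y. \<forall>u\<ge>0. \<forall>v\<ge>0. u + v = 1 \<longrightarrow>
        g (u *\<^sub>R x + v *\<^sub>R y) \<le> ereal u * g x + ereal v * g y)"

definition integrally_convex :: "(int ^ 'n \<Rightarrow> ereal) \<Rightarrow> bool" where
  "integrally_convex f \<longleftrightarrow> ereal_convex (local_convex_ext f)"

definition five_ineqs :: "(int \<Rightarrow> int \<Rightarrow> ereal) \<Rightarrow> bool" where
  "five_ineqs g \<longleftrightarrow>
     g 0 0 + g 2 1 \<ge> g 1 1 + g 1 0 \<and>
     g 0 0 + g 2 (-1) \<ge> g 1 (-1) + g 1 0 \<and>
     g 0 0 + g 2 0 \<ge> 2 * g 1 0 \<and>
     g 0 0 + g 2 2 \<ge> 2 * g 1 1 \<and>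
     g 0 0 + g 2 (-2) \<ge> 2 * g 1 (-1)"

text \<open>Ensures that the sums over \<open>int_nbhd x\<close> are genuine (library sums over infinite sets
  are \<open>0\<close>).\<close>
lemma finite_int_nbhd: "finite (int_nbhd (x :: real ^ 'n))"
proof -
  let ?B = "\<Pi>\<^sub>E i\<in>(UNIV :: 'n set). {\<lfloor>x $ i\<rfloor> - 1 .. \<lceil>x $ i\<rceil> + 1}"
  have "z $ i \<in> {\<lfloor>x $ i\<rfloor> - 1 .. \<lceil>x $ i\<rceil> + 1}" if "z \<in> int_nbhd x" for z i
  proof -
    have "\<bar>x $ i - real_of_int (z $ i)\<bar> < 1"
      using that by (simp add: int_nbhd_def)
    then show ?thesis
      unfolding atLeastAtMost_iff by linarith
  qed
  then have "vec_nth ` int_nbhd x \<subseteq> ?B"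
    by (auto simp: PiE_iff simp del: atLeastAtMost_iff)
  moreover have "finite ?B"
    by (intro finite_PiE) auto
  ultimately have "finite (vec_nth ` int_nbhd x)"
    by (rule finite_subset)
  moreover have "inj_on vec_nth (int_nbhd x)"
    by (auto simp: inj_on_def vec_eq_iff)
  ultimately show ?thesis
    by (rule finite_imageD)
qed

end

theory Submission
  imports Defs
begin

text \<open>
  Necessity is convexity of the local extension \<open>f\<^sup>~\<close> at the midpoints of the pairs occurring in the
  five inequalities, where the integral neighbourhood has at most two elements.

  For sufficiency it is enough that every convex combination of points of the graph of \<open>f\<close> lying
  over \<open>x\<close> dominates one that uses only points over the integral neighbourhood of \<open>x\<close>. Among the
  combinations over a finite box that are no more expensive, take one minimizing the mean of
  \<open>|y|\<^sup>2\<close>. If two points \<open>y, y'\<close> of its support were at \<open>\<ell>\<^sub>\<infinity>\<close>-distance at least 2, mass could be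
  moved from them to two other lattice points with the same sum, not increasing the cost and
  decreasing the mean of \<open>|y|\<^sup>2\<close>. Hence the support lies in a unit square, and so in the
  neighbourhood of \<open>x\<close>.

  The exchange works as follows. Up to symmetry \<open>y' = y + a e + b p\<close> with orthogonal unit vectors
  \<open>e, p\<close> and \<open>0 \<le> b \<le> a\<close>. Integral convexity of \<open>dom f\<close> puts all lattice points vertically within
  distance less than 1 of the segment from \<open>y\<close> to \<open>y'\<close> into \<open>dom f\<close>. If \<open>b < a\<close>, the increments
  \<open>f (q + e) - f q\<close> are nondecreasing along a staircase of such points \<open>q\<close> by the inequalities for
  \<open>2e\<close> and \<open>2e + p\<close>, and comparing the first with the last one gives
  \<open>f (y + e) + f (y' - e) \<le> f y + f y'\<close>. If \<open>b = a\<close>, the same works along the diagonal.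
\<close>

section \<open>Telescoping increments along lattice paths\<close>

text \<open>By \<open>b < a\<close> the heights \<open>s k\<close> grow by 0 or 1 per step, so
  \<open>straight\<close> or \<open>skew\<close> shows that the increment
  \<open>F (k + 1) (s k) - F k (s k)\<close> does not decrease with \<open>k\<close>. The conclusion
  compares its first and last values.\<close>

lemma staircase_telescope:
  fixes F :: "int \<Rightarrow> int \<Rightarrow> real"
  assumes ab: "0 \<le> b" "b < a"
    and band: "\<And>k j. 0 \<le> k \<Longrightarrow> k \<le> a \<Longrightarrow> \<bar>a * j - k * b\<bar> < a \<Longrightarrow> D k j"
    and straight: "\<And>k j. D k j \<Longrightarrow> D (k + 2) j \<Longrightarrow> 2 * F (k + 1) j \<le> F k j + F (k + 2) j"
    and skew: "\<And>k j. D k j \<Longrightarrow> D (k + 2) (j + 1) \<Longrightarrow>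
      F (k + 1) (j + 1) + F (k + 1) j \<le> F k j + F (k + 2) (j + 1)"
  shows "F 1 0 + F (a - 1) b \<le> F 0 0 + F a b"
proof -
  \<comment> \<open>The shift by 1 makes both \<open>(k, s k)\<close> and \<open>(k + 1, s k)\<close> lie in the band.\<close>
  define s where "s k = ((k + 1) * b) div a" for k :: int
  have s: "a * s k \<le> (k + 1) * b" "(k + 1) * b < a * s k + a" for k
  proof -
    have "(k + 1) * b = a * s k + ((k + 1) * b) mod a" by (simp add: s_def)
    moreover have "0 \<le> ((k + 1) * b) mod a" "((k + 1) * b) mod a < a" using ab by auto
    ultimately show "a * s k \<le> (k + 1) * b" "(k + 1) * b < a * s k + a" by linarith+
  qed
  have inc: "F 1 (s 0) - F 0 (s 0) \<le> F (int n + 1) (s (int n)) - F (int n) (s (int n))"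
    if "int n < a" for n
    using that
  proof (induction n)
    case 0
    then show ?case by simp
  next
    case (Suc n)
    define k where "k = int n"
    have k: "0 \<le> k" "k + 2 \<le> a" "int (Suc n) = k + 1" using Suc.prems by (auto simp: k_def)
    have IH: "F 1 (s 0) - F 0 (s 0) \<le> F (k + 1) (s k) - F k (s k)"
      using Suc by (simp add: k_def)
    have e: "(k + 1 + 1) * b = k * b + 2 * b" "(k + 1) * b = k * b + b" "(k + 2) * b = k * b + 2 * b"
      by (auto simp: algebra_simps)
    note s1 = s[of k, unfolded e] and s2 = s[of "k + 1", unfolded e]
    \<comment> \<open>\<open>s k\<close> and \<open>s (k + 1)\<close> are floors of two numbers
      whose difference \<open>b / a\<close> is nonnegative and less than 1.\<close>
    have "a * s (k + 1) < a * (s k + 2)" "a * s k < a * (s (k + 1) + 1)"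
      unfolding distrib_left using s1 s2 ab by linarith+
    then have "s (k + 1) = s k \<or> s (k + 1) = s k + 1"
      using ab by (simp add: mult_less_cancel_left_pos) linarith
    moreover have "D k (s k)"
      using s1 ab k by (intro band) auto
    moreover have "D (k + 2) (s (k + 1))"
      using s2 ab k by (intro band) (auto simp: e)
    ultimately have "F (k + 1) (s k) - F k (s k) \<le> F (k + 2) (s (k + 1)) - F (k + 1) (s (k + 1))"
      using straight[of k "s k"] skew[of k "s k"] by auto
    with IH show ?case
      unfolding k(3) by (simp add: add.assoc)
  qed
  have "s 0 = 0" using ab by (simp add: s_def)
  moreover have "s (a - 1) = b" using ab by (simp add: s_def)
  ultimately show ?thesis using inc[of "nat (a - 1)"] ab by simp
qed

text \<open>The shear from \<open>(k, j)\<close> to \<open>(k, k + j)\<close> turns the diagonal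
  into a staircase with \<open>b = 0\<close>; restricting the domain to \<open>j = 0\<close> makes
  the skew hypothesis vacuous.\<close>

lemma diagonal_telescope:
  fixes F :: "int \<Rightarrow> int \<Rightarrow> real"
  assumes a: "0 < a"
    and dom: "\<And>k. 0 \<le> k \<Longrightarrow> k \<le> a \<Longrightarrow> D k k"
    and diag: "\<And>k j. D k j \<Longrightarrow> D (k + 2) (j + 2) \<Longrightarrow>
      2 * F (k + 1) (j + 1) \<le> F k j + F (k + 2) (j + 2)"
  shows "F 1 1 + F (a - 1) (a - 1) \<le> F 0 0 + F a a"
proof -
  have "F 1 (1 + 0) + F (a - 1) (a - 1 + 0) \<le> F 0 (0 + 0) + F a (a + 0)"
  proof (rule staircase_telescope[where b = 0 and F = "\<lambda>k j. F k (k + j)"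
        and D = "\<lambda>k j. j = 0 \<and> D k k"])
    show "2 * F (k + 1) (k + 1 + j) \<le> F k (k + j) + F (k + 2) (k + 2 + j)"
      if "j = 0 \<and> D k k" "j = 0 \<and> D (k + 2) (k + 2)" for k j
      using diag[of k k] that by simp
    show "j = 0 \<and> D k k" if "0 \<le> k" "k \<le> a" "\<bar>a * j - k * 0\<bar> < a" for k j
      using dom[of k] that a by (auto simp: abs_mult)
  qed (use a in auto)
  then show ?thesis by simp
qed

section \<open>Lattice points near a segment\<close>

text \<open>The axis \<open>i\<close> and the signs \<open>\<sigma>\<close>, \<open>\<tau>\<close>
  encode the eight symmetries of the square lattice, so that the single configuration
  \<open>0 \<le> b \<le> a\<close> covers every pair of points.\<close>

definition lattice_pt :: "2 \<Rightarrow> int \<Rightarrow> int \<Rightarrow> int ^ 2 \<Rightarrow> int \<Rightarrow> int \<Rightarrow> int ^ 2" where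
  "lattice_pt i \<sigma> \<tau> y k j = (\<chi> m. if m = i then y $ m + \<sigma> * k else y $ m + \<tau> * j)"

lemma all_2_other:
  fixes i i' :: 2
  assumes "i' \<noteq> i"
  shows "(\<forall>m. P m) \<longleftrightarrow> P i \<and> P i'"
  using assms exhaust_2 by (metis (full_types))

text \<open>Let \<open>x\<close> be the point of the segment in column \<open>k\<close>. Its
  coordinate \<open>i\<close> is an integer, so its integral neighbours all lie in that column, at
  no more than two heights. If the one at height \<open>j\<close> were missing from
  \<open>S\<close>, the others would lie strictly on one side of \<open>x\<close>, and
  \<open>x\<close> would not be in their hull.\<close>

lemma lattice_band_mem:
  fixes S :: "(int ^ 2) set"
  assumes S: "integrally_convex_set S"
    and sgn: "\<bar>\<sigma>\<bar> = 1" "\<bar>\<tau>\<bar> = 1"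
    and mem: "y \<in> S" "lattice_pt i \<sigma> \<tau> y a b \<in> S"
    and k: "0 \<le> k" "k \<le> a" and j: "\<bar>a * j - k * b\<bar> < a"
  shows "lattice_pt i \<sigma> \<tau> y k j \<in> S"
proof (rule ccontr)
  assume nmem: "lattice_pt i \<sigma> \<tau> y k j \<notin> S"
  obtain i' where i': "i' \<noteq> i" by (metis (full_types) exhaust_2 zero_neq_one)
  define y' where "y' = lattice_pt i \<sigma> \<tau> y a b"
  have a: "a > 0" using j by linarith
  \<comment> \<open>The height, measured from \<open>y\<close> in direction \<open>\<tau>\<close>,
    at which the segment crosses column \<open>k\<close>.\<close>
  define r where "r = real_of_int (k * b) / real_of_int a"
  define x where "x = (1 - real_of_int k / real_of_int a) *\<^sub>R rvec y
    + (real_of_int k / real_of_int a) *\<^sub>R rvec y'"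
  have xi: "x $ i = real_of_int (y $ i + \<sigma> * k)"
    and xi': "x $ i' = real_of_int (y $ i') + real_of_int \<tau> * r"
    using a i' by (auto simp: x_def r_def y'_def lattice_pt_def rvec_def field_simps)
  have x_hull: "x \<in> convex hull (rvec ` S)"
    unfolding x_def using mem k a
    by (intro convexD) (auto simp: y'_def hull_inc)
  have tt: "real_of_int \<tau> * real_of_int \<tau> = 1" "\<tau> * \<tau> = 1" using sgn by (auto simp: abs_if split: if_splits)
  have rj: "\<bar>r - j\<bar> < 1"
  proof -
    have "\<bar>real_of_int (a * j - k * b)\<bar> < real_of_int a" using j by linarith
    moreover have "real_of_int (a * j - k * b) = a * (j - r)" using a by (simp add: r_def field_simps)
    ultimately have "real_of_int a * \<bar>j - r\<bar> < real_of_int a * 1" using a by (simp add: abs_mult)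
    then show ?thesis using a by (simp add: abs_minus_commute)
  qed
  have near: "\<exists>q. real_of_int (z $ i') = y $ i' + \<tau> * q \<and> \<bar>r - real_of_int q\<bar> < 1 \<and> q \<noteq> j"
    if z: "z \<in> S \<inter> int_nbhd x" for z
  proof (intro exI conjI)
    let ?q = "\<tau> * (z $ i' - y $ i')"
    have eq: "z $ i' = y $ i' + \<tau> * ?q" using tt by (simp add: mult.assoc[symmetric])
    then show "real_of_int (z $ i') = y $ i' + \<tau> * ?q" by (metis of_int_add of_int_mult)
    have n: "\<bar>x $ i - z $ i\<bar> < 1" "\<bar>x $ i' - z $ i'\<bar> < 1" using z by (auto simp: int_nbhd_def)
    then have zi: "z $ i = y $ i + \<sigma> * k" unfolding xi by linarith
    have "x $ i' - z $ i' = \<tau> * (r - ?q)"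
      using tt by (simp add: xi' algebra_simps) (simp add: mult.assoc[symmetric])
    then show "\<bar>r - real_of_int ?q\<bar> < 1" using n sgn by (simp add: abs_mult flip: of_int_abs)
    show "?q \<noteq> j"
    proof
      assume "?q = j"
      then have "z = lattice_pt i \<sigma> \<tau> y k j"
        using zi eq i' by (simp add: vec_eq_iff all_2_other[OF i'] lattice_pt_def)
      then show False using nmem z by auto
    qed
  qed
  have x_loc: "x \<in> convex hull (rvec ` (S \<inter> int_nbhd x))"
    using S x_hull by (auto simp: integrally_convex_set_def)
  have tx: "\<tau> * x $ i' = \<tau> * y $ i' + r"
    using tt by (simp add: xi' distrib_left mult.assoc[symmetric])
  show False
  proof (cases "real_of_int j \<le> r")
    case True
    \<comment> \<open>Here every \<open>q\<close> is at least \<open>j + 1 > r\<close>, so a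
      half-space separates the neighbours from \<open>x\<close>.\<close>
    have "rvec ` (S \<inter> int_nbhd x) \<subseteq> {w. inner (axis i' (real_of_int \<tau>)) w \<ge> \<tau> * y $ i' + j + 1}"
    proof clarify
      fix z assume "z \<in> S" "z \<in> int_nbhd x"
      then obtain q where q: "real_of_int (z $ i') = y $ i' + \<tau> * q" "\<bar>r - real_of_int q\<bar> < 1" "q \<noteq> j"
        using near by auto
      have "q \<ge> j + 1" using q True rj by linarith
      moreover have "\<tau> * real_of_int (z $ i') = \<tau> * y $ i' + q"
        using tt by (simp add: q distrib_left mult.assoc[symmetric])
      ultimately show "inner (axis i' (real_of_int \<tau>)) (rvec z) \<ge> \<tau> * y $ i' + j + 1"
        by (simp add: inner_axis' rvec_def)
    qed
    then have "x \<in> {w. inner (axis i' (real_of_int \<tau>)) w \<ge> \<tau> * y $ i' + j + 1}"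
      by (rule subsetD[OF hull_minimal x_loc]) (rule convex_halfspace_ge)
    then show False using tx rj by (simp add: inner_axis')
  next
    case False
    have "rvec ` (S \<inter> int_nbhd x) \<subseteq> {w. inner (axis i' (real_of_int \<tau>)) w \<le> \<tau> * y $ i' + j - 1}"
    proof clarify
      fix z assume "z \<in> S" "z \<in> int_nbhd x"
      then obtain q where q: "real_of_int (z $ i') = y $ i' + \<tau> * q" "\<bar>r - real_of_int q\<bar> < 1" "q \<noteq> j"
        using near by auto
      have "q \<le> j - 1" using q False rj by linarith
      moreover have "\<tau> * real_of_int (z $ i') = \<tau> * y $ i' + q"
        using tt by (simp add: q distrib_left mult.assoc[symmetric])
      ultimately show "inner (axis i' (real_of_int \<tau>)) (rvec z) \<le> \<tau> * y $ i' + j - 1"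
        by (simp add: inner_axis' rvec_def)
    qed
    then have "x \<in> {w. inner (axis i' (real_of_int \<tau>)) w \<le> \<tau> * y $ i' + j - 1}"
      by (rule subsetD[OF hull_minimal x_loc]) (rule convex_halfspace_le)
    then show False using tx rj by (simp add: inner_axis')
  qed
qed

section \<open>Convex hulls of the graph and the local extension\<close>

lemma rvec_eq_iff [simp]: "rvec y = rvec z \<longleftrightarrow> y = z"
  by (simp add: rvec_def vec_eq_iff)

lemma convex_hull_image_finiteE:
  fixes G :: "'b \<Rightarrow> 'a::real_vector"
  assumes "p \<in> convex hull (G ` B)" "finite B" "inj_on G B"
  obtains l where "\<And>y. y \<in> B \<Longrightarrow> 0 \<le> l y" "sum l B = 1" "(\<Sum>y\<in>B. l y *\<^sub>R G y) = p"
proof -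
  obtain u where "\<forall>x\<in>G ` B. 0 \<le> u x" "sum u (G ` B) = 1" "(\<Sum>x\<in>G ` B. u x *\<^sub>R x) = p"
    using assms(1) assms(2) by (auto simp: convex_hull_finite)
  then show thesis
    using assms(3) that[of "u \<circ> G"] by (simp add: sum.reindex o_def)
qed

lemma sum_in_convex_hull_image:
  fixes G :: "'b \<Rightarrow> 'a::real_vector"
  assumes "finite B" "\<And>y. y \<in> B \<Longrightarrow> 0 \<le> l y" "sum l B = 1"
    and "\<And>y. y \<in> B \<Longrightarrow> l y \<noteq> 0 \<Longrightarrow> y \<in> C"
  shows "(\<Sum>y\<in>B. l y *\<^sub>R G y) \<in> convex hull (G ` C)"
proof -
  have "(\<Sum>y\<in>B \<inter> C. l y *\<^sub>R G y) \<in> convex hull (G ` C)"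
  proof (rule convex_sum)
    show "sum l (B \<inter> C) = 1"
      using assms by (subst assms(3)[symmetric], intro sum.mono_neutral_left) auto
  qed (use assms in \<open>auto simp: hull_inc\<close>)
  also have "(\<Sum>y\<in>B \<inter> C. l y *\<^sub>R G y) = (\<Sum>y\<in>B. l y *\<^sub>R G y)"
    using assms by (intro sum.mono_neutral_left) auto
  finally show ?thesis .
qed

text \<open>Off the effective domain \<open>graph_pt f\<close> has the junk second component \<open>0\<close>.\<close>
definition graph_pt :: "(int ^ 'n \<Rightarrow> ereal) \<Rightarrow> int ^ 'n \<Rightarrow> (real ^ 'n) \<times> real" where
  "graph_pt f y = (rvec y, real_of_ereal (f y))"

lemma ereal_of_effdom:
  assumes "f y \<noteq> -\<infinity>" "y \<in> effdom f"
  shows "ereal (real_of_ereal (f y)) = f y"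
  using assms by (cases "f y") (auto simp: effdom_def)

text \<open>A cost below \<open>c\<close> is not \<open>\<infinity>\<close>, so no mass lies off the
  effective domain and the combination is one of real graph points. The strict bound is what
  extracts a feasible combination from the infimum.\<close>

lemma local_convex_ext_lessD:
  fixes f :: "int ^ 'n \<Rightarrow> ereal"
  assumes f: "\<And>x. f x \<noteq> -\<infinity>" and less: "local_convex_ext f x < c"
  obtains c' where "ereal c' < c" "(x, c') \<in> convex hull (graph_pt f ` (effdom f \<inter> int_nbhd x))"
proof -
  obtain l where l: "(\<Sum>y\<in>int_nbhd x. l y *\<^sub>R rvec y) = x" "(\<Sum>y\<in>int_nbhd x. l y) = 1"
      "\<forall>y\<in>int_nbhd x. 0 \<le> l y" and lc: "(\<Sum>y\<in>int_nbhd x. ereal (l y) * f y) < c"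
    using less unfolding local_convex_ext_def Inf_less_iff by auto
  have dom: "y \<in> effdom f" if "y \<in> int_nbhd x" "l y \<noteq> 0" for y
  proof (rule ccontr)
    assume "y \<notin> effdom f"
    then have "ereal (l y) * f y = \<infinity>" using l(3) that by (auto simp: effdom_def)
    then have "(\<Sum>y\<in>int_nbhd x. ereal (l y) * f y) = \<infinity>"
      using that finite_int_nbhd by (subst sum_Pinfty) blast
    then show False using lc by simp
  qed
  have "(\<Sum>y\<in>int_nbhd x. ereal (l y) * f y) = (\<Sum>y\<in>int_nbhd x. ereal (l y * real_of_ereal (f y)))"
  proof (intro sum.cong refl)
    fix y assume "y \<in> int_nbhd x"
    then show "ereal (l y) * f y = ereal (l y * real_of_ereal (f y))"
      using dom[of y] ereal_of_effdom[of f y, OF f]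
      by (cases "l y = 0") (simp_all flip: zero_ereal_def times_ereal.simps(1))
  qed
  then have "ereal (\<Sum>y\<in>int_nbhd x. l y * real_of_ereal (f y)) < c" using lc by simp
  moreover have "(x, \<Sum>y\<in>int_nbhd x. l y * real_of_ereal (f y)) = (\<Sum>y\<in>int_nbhd x. l y *\<^sub>R graph_pt f y)"
    using l(1) by (simp add: graph_pt_def prod_eq_iff fst_sum snd_sum)
  moreover have "\<dots> \<in> convex hull (graph_pt f ` (effdom f \<inter> int_nbhd x))"
    using l dom by (intro sum_in_convex_hull_image finite_int_nbhd) auto
  ultimately show thesis using that by metis
qed

lemma local_convex_ext_le:
  fixes f :: "int ^ 'n \<Rightarrow> ereal"
  assumes f: "\<And>x. f x \<noteq> -\<infinity>"
    and mem: "(x, c) \<in> convex hull (graph_pt f ` (effdom f \<inter> int_nbhd x))"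
  shows "local_convex_ext f x \<le> ereal c"
proof -
  let ?B = "effdom f \<inter> int_nbhd x"
  have fin: "finite ?B" and inj: "inj_on (graph_pt f) ?B"
    by (auto simp: inj_on_def graph_pt_def finite_int_nbhd)
  obtain l where l: "\<And>y. y \<in> ?B \<Longrightarrow> 0 \<le> l y" "sum l ?B = 1" "(\<Sum>y\<in>?B. l y *\<^sub>R graph_pt f y) = (x, c)"
    using convex_hull_image_finiteE[OF mem fin inj] by blast
  have lx: "(\<Sum>y\<in>?B. l y *\<^sub>R rvec y) = x" and lc: "(\<Sum>y\<in>?B. l y * real_of_ereal (f y)) = c"
    using l(3) by (auto simp: graph_pt_def prod_eq_iff fst_sum snd_sum)
  \<comment> \<open>The weights are extended by 0; as \<open>0 * \<infinity> = 0\<close>, points off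
    the effective domain then add no cost.\<close>
  define m where "m y = (if y \<in> effdom f then l y else 0)" for y
  have ext: "(\<Sum>y\<in>int_nbhd x. h y) = (\<Sum>y\<in>?B. h y)" if "\<And>y. y \<notin> effdom f \<Longrightarrow> h y = 0"
    for h :: "int ^ 'n \<Rightarrow> 'b::comm_monoid_add"
    using that finite_int_nbhd by (intro sum.mono_neutral_right) auto
  have "(\<Sum>y\<in>int_nbhd x. m y *\<^sub>R rvec y) = x"
    by (subst ext) (auto simp: m_def intro!: trans[OF sum.cong lx])
  moreover have "(\<Sum>y\<in>int_nbhd x. m y) = 1"
    by (subst ext) (auto simp: m_def intro!: trans[OF sum.cong l(2)])
  moreover have "(\<Sum>y\<in>int_nbhd x. ereal (m y) * f y) = ereal c"
  proof -
    have "(\<Sum>y\<in>int_nbhd x. ereal (m y) * f y) = (\<Sum>y\<in>?B. ereal (m y) * f y)"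
      by (intro ext) (simp add: m_def)
    also have "\<dots> = (\<Sum>y\<in>?B. ereal (l y * real_of_ereal (f y)))"
    proof (intro sum.cong refl)
      fix y assume "y \<in> ?B"
      then show "ereal (m y) * f y = ereal (l y * real_of_ereal (f y))"
        using ereal_of_effdom[of f y, OF f] by (simp add: m_def flip: times_ereal.simps(1))
    qed
    finally show ?thesis by (simp add: lc)
  qed
  ultimately show ?thesis
    unfolding local_convex_ext_def using l(1)
    by (intro Inf_lower CollectI exI[of _ m]) (auto simp: m_def)
qed

section \<open>The five inequalities under lattice symmetries\<close>

lemma ereal_mult_2: "2 * (x :: ereal) = x + x"
  by (cases x) auto

text \<open>For \<open>\<sigma> = 1\<close> the inequality is based at \<open>(m, n)\<close>. For
  \<open>\<sigma> = -1\<close> it is read from the opposite endpoint, with first coordinate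
  \<open>m - 2\<close>, which therefore has to lie in the domain as well.\<close>

lemma grid_ineqs:
  fixes F :: "int \<Rightarrow> int \<Rightarrow> ereal"
  assumes five: "\<And>m n. F m n < \<infinity> \<Longrightarrow> five_ineqs (\<lambda>a b. F (m + a) (n + b))"
    and sgn: "\<bar>\<sigma>\<bar> = 1" "\<bar>\<tau>\<bar> = 1" and dom: "F m n < \<infinity>"
  shows "F (m + 2 * \<sigma>) n < \<infinity> \<Longrightarrow> F (m + \<sigma>) n + F (m + \<sigma>) n \<le> F m n + F (m + 2 * \<sigma>) n"
    and "F (m + 2 * \<sigma>) (n + \<tau>) < \<infinity> \<Longrightarrow>
      F (m + \<sigma>) (n + \<tau>) + F (m + \<sigma>) n \<le> F m n + F (m + 2 * \<sigma>) (n + \<tau>)"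
    and "F (m + 2 * \<sigma>) (n + 2 * \<tau>) < \<infinity> \<Longrightarrow>
      F (m + \<sigma>) (n + \<tau>) + F (m + \<sigma>) (n + \<tau>) \<le> F m n + F (m + 2 * \<sigma>) (n + 2 * \<tau>)"
proof -
  have s: "\<sigma> = 1 \<or> \<sigma> = -1" "\<tau> = 1 \<or> \<tau> = -1" using sgn by linarith+
  note * = five[unfolded five_ineqs_def ereal_mult_2]
  show "F (m + \<sigma>) n + F (m + \<sigma>) n \<le> F m n + F (m + 2 * \<sigma>) n" if "F (m + 2 * \<sigma>) n < \<infinity>"
    using s(1) *[of m n] *[of "m - 2" n] dom that by (auto simp: add.commute)
  show "F (m + \<sigma>) (n + \<tau>) + F (m + \<sigma>) n \<le> F m n + F (m + 2 * \<sigma>) (n + \<tau>)"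
    if "F (m + 2 * \<sigma>) (n + \<tau>) < \<infinity>"
    using s *[of m n] *[of "m - 2" "n + \<tau>"] dom that by (auto simp: add.commute)
  show "F (m + \<sigma>) (n + \<tau>) + F (m + \<sigma>) (n + \<tau>) \<le> F m n + F (m + 2 * \<sigma>) (n + 2 * \<tau>)"
    if "F (m + 2 * \<sigma>) (n + 2 * \<tau>) < \<infinity>"
    using s *[of m n] *[of "m - 2" "n + 2 * \<tau>"] dom that by (auto simp: add.commute)
qed

lemma lattice_pt_ineqs:
  fixes f :: "int ^ 2 \<Rightarrow> ereal"
  assumes five: "\<forall>z\<in>effdom f. five_ineqs (\<lambda>x1 x2. f (z + vector [x1, x2])) \<and>
      five_ineqs (\<lambda>x1 x2. f (z + vector [x2, x1]))"
    and sgn: "\<bar>\<sigma>\<bar> = 1" "\<bar>\<tau>\<bar> = 1"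
    and dom: "lattice_pt i \<sigma> \<tau> y k j \<in> effdom f"
  shows "lattice_pt i \<sigma> \<tau> y (k + 2) j \<in> effdom f \<Longrightarrow>
      f (lattice_pt i \<sigma> \<tau> y (k + 1) j) + f (lattice_pt i \<sigma> \<tau> y (k + 1) j)
      \<le> f (lattice_pt i \<sigma> \<tau> y k j) + f (lattice_pt i \<sigma> \<tau> y (k + 2) j)" (is "?A1 \<Longrightarrow> ?B1")
    and "lattice_pt i \<sigma> \<tau> y (k + 2) (j + 1) \<in> effdom f \<Longrightarrow>
      f (lattice_pt i \<sigma> \<tau> y (k + 1) (j + 1)) + f (lattice_pt i \<sigma> \<tau> y (k + 1) j)
      \<le> f (lattice_pt i \<sigma> \<tau> y k j) + f (lattice_pt i \<sigma> \<tau> y (k + 2) (j + 1))" (is "?A2 \<Longrightarrow> ?B2")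
    and "lattice_pt i \<sigma> \<tau> y (k + 2) (j + 2) \<in> effdom f \<Longrightarrow>
      f (lattice_pt i \<sigma> \<tau> y (k + 1) (j + 1)) + f (lattice_pt i \<sigma> \<tau> y (k + 1) (j + 1))
      \<le> f (lattice_pt i \<sigma> \<tau> y k j) + f (lattice_pt i \<sigma> \<tau> y (k + 2) (j + 2))" (is "?A3 \<Longrightarrow> ?B3")
proof -
  \<comment> \<open>\<open>F\<close> reads \<open>f\<close> with coordinate \<open>i\<close> first,
    so the two families of inequalities in \<open>five\<close> serve the two values of
    \<open>i\<close>.\<close>
  define F where "F = (\<lambda>m n. if i = 1 then f (vector [m, n]) else f (vector [n, m]))"
  obtain i' where i': "i' \<noteq> i" "i = 1 \<and> i' = 2 \<or> i = 2 \<and> i' = 1"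
    using exhaust_2[of i] by (metis one_neq_zero zero_neq_one exhaust_2 num1_eq1)
  have plus: "vector [m, n] + vector [a, b] = (vector [m + a, n + b] :: int ^ 2)" for m n a b
    by (simp add: vec_eq_iff forall_2)
  have F5: "five_ineqs (\<lambda>a b. F (m + a) (n + b))" if "F m n < \<infinity>" for m n
  proof (cases "i = 1")
    case True
    then show ?thesis using five[rule_format, of "vector [m, n]"] that
      by (simp add: F_def plus effdom_def)
  next
    case False
    then show ?thesis using five[rule_format, of "vector [n, m]"] that
      by (simp add: F_def plus effdom_def)
  qed
  have pt: "f (lattice_pt i \<sigma> \<tau> y a b) = F (y $ i + \<sigma> * a) (y $ i' + \<tau> * b)" for a b
  proof -
    have "i = 1 \<Longrightarrow> lattice_pt i \<sigma> \<tau> y a b = vector [y $ i + \<sigma> * a, y $ i' + \<tau> * b]"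
      "i \<noteq> 1 \<Longrightarrow> lattice_pt i \<sigma> \<tau> y a b = vector [y $ i' + \<tau> * b, y $ i + \<sigma> * a]"
      using i' by (auto simp: vec_eq_iff forall_2 lattice_pt_def)
    then show ?thesis by (simp add: F_def)
  qed
  have eqs: "y $ i + \<sigma> * (k + 2) = y $ i + \<sigma> * k + 2 * \<sigma>" "y $ i + \<sigma> * (k + 1) = y $ i + \<sigma> * k + \<sigma>"
    "y $ i' + \<tau> * (j + 2) = y $ i' + \<tau> * j + 2 * \<tau>" "y $ i' + \<tau> * (j + 1) = y $ i' + \<tau> * j + \<tau>"
    by (simp_all add: algebra_simps)
  note dom' = dom[unfolded effdom_def mem_Collect_eq pt]
  show "?A1 \<Longrightarrow> ?B1" "?A2 \<Longrightarrow> ?B2" "?A3 \<Longrightarrow> ?B3"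
    unfolding effdom_def mem_Collect_eq pt eqs
    by (rule grid_ineqs[where F = F, OF _ sgn]; (erule F5 | rule dom' | assumption))+
qed

section \<open>Exchanging two distant points\<close>

definition sq_len :: "int ^ 2 \<Rightarrow> int" where
  "sq_len z = (\<Sum>m\<in>UNIV. (z $ m)\<^sup>2)"

text \<open>\<open>u\<close> and \<open>v\<close> arise from \<open>y\<close> and \<open>y'\<close>
  by one step towards each other, along the axis of larger difference if \<open>b < a\<close> and
  diagonally if \<open>b = a\<close>. Lying between \<open>y\<close> and \<open>y'\<close> keeps
  them in every box that contains both.\<close>

lemma exchange:
  fixes f :: "int ^ 2 \<Rightarrow> ereal"
  assumes f: "\<And>x. f x \<noteq> -\<infinity>"
    and S: "integrally_convex_set (effdom f)"
    and five: "\<forall>z\<in>effdom f. five_ineqs (\<lambda>x1 x2. f (z + vector [x1, x2])) \<and>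
      five_ineqs (\<lambda>x1 x2. f (z + vector [x2, x1]))"
    and mem: "y \<in> effdom f" "y' \<in> effdom f" and far: "2 \<le> \<bar>y $ m - y' $ m\<bar>"
  obtains u v where "u \<in> effdom f" "v \<in> effdom f" "u + v = y + y'"
    "\<And>m. min (y $ m) (y' $ m) \<le> u $ m \<and> u $ m \<le> max (y $ m) (y' $ m)"
    "\<And>m. min (y $ m) (y' $ m) \<le> v $ m \<and> v $ m \<le> max (y $ m) (y' $ m)"
    "real_of_ereal (f u) + real_of_ereal (f v) \<le> real_of_ereal (f y) + real_of_ereal (f y')"
    "sq_len u + sq_len v < sq_len y + sq_len y'"
proof -
  \<comment> \<open>Choosing \<open>i\<close> with the larger difference gives
    \<open>b \<le> a\<close>, and \<open>far\<close> then gives \<open>2 \<le> a\<close>.\<close>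
  obtain i i' where i': "i' \<noteq> i" and ii': "\<bar>y' $ i' - y $ i'\<bar> \<le> \<bar>y' $ i - y $ i\<bar>"
    by (metis linear one_neq_zero)
  define a where "a = \<bar>y' $ i - y $ i\<bar>"
  define b where "b = \<bar>y' $ i' - y $ i'\<bar>"
  define \<sigma> where "\<sigma> = (if y' $ i < y $ i then - 1 else 1 :: int)"
  define \<tau> where "\<tau> = (if y' $ i' < y $ i' then - 1 else 1 :: int)"
  have sgn: "\<bar>\<sigma>\<bar> = 1" "\<bar>\<tau>\<bar> = 1" by (auto simp: \<sigma>_def \<tau>_def)
  have s: "\<sigma> = 1 \<or> \<sigma> = -1" "\<tau> = 1 \<or> \<tau> = -1" by (auto simp: \<sigma>_def \<tau>_def)
  have "m = i \<or> m = i'" using i' exhaust_2 by (metis (full_types))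
  then have ab: "0 \<le> b" "b \<le> a" "2 \<le> a" using far ii' by (auto simp: a_def b_def)
  let ?P = "lattice_pt i \<sigma> \<tau> y"
  have P: "?P k j $ i = y $ i + \<sigma> * k" "?P k j $ i' = y $ i' + \<tau> * j" for k j
    using i' by (auto simp: lattice_pt_def)
  have y: "y = ?P 0 0" and y': "y' = ?P a b"
    unfolding vec_eq_iff all_2_other[OF i'] P by (auto simp: a_def b_def \<sigma>_def \<tau>_def)
  have mem': "?P a b \<in> effdom f" using mem y' by simp
  note band = lattice_band_mem[OF S sgn mem(1) mem']
  let ?F = "\<lambda>k j. real_of_ereal (f (?P k j))"
  \<comment> \<open>The finite right-hand side forces \<open>f p\<close> and \<open>f q\<close> to
    be finite, so the inequality passes to the reals.\<close>
  have real_ineq: "real_of_ereal (f p) + real_of_ereal (f q) \<le> real_of_ereal (f w) + real_of_ereal (f z)"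
    if "w \<in> effdom f" "z \<in> effdom f" "f p + f q \<le> f w + f z" for p q w z
    using that f[of p] f[of q] f[of w] f[of z]
    by (cases "f p"; cases "f q"; cases "f w"; cases "f z") (auto simp: effdom_def)
  note ineqs = lattice_pt_ineqs[OF five sgn]
  have U: "UNIV = {i, i'}" using i' exhaust_2 by (metis (full_types) UNIV_eq_I insertCI)
  have sq: "sq_len z = (z $ i)\<^sup>2 + (z $ i')\<^sup>2" for z
    unfolding sq_len_def U using i' by simp
  have between: "min (y $ m) (y' $ m) \<le> ?P k j $ m \<and> ?P k j $ m \<le> max (y $ m) (y' $ m)"
    if "0 \<le> k" "k \<le> a" "0 \<le> j" "j \<le> b" for k j m
  proof -
    have "m = i \<or> m = i'" using U by auto
    then show ?thesis
      unfolding y' using that s by (elim disjE[of "m = i"]) (auto simp only: P; auto)+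
  qed
  show thesis
  proof (cases "b < a")
    case True
    have "?F 1 0 + ?F (a - 1) b \<le> ?F 0 0 + ?F a b"
    proof (rule staircase_telescope[where F = ?F and D = "\<lambda>k j. ?P k j \<in> effdom f"])
      show "2 * ?F (k + 1) j \<le> ?F k j + ?F (k + 2) j"
        if "?P k j \<in> effdom f" "?P (k + 2) j \<in> effdom f" for k j
        using real_ineq[OF that ineqs(1)[OF that]] by simp
    qed (use ab True band real_ineq ineqs in auto)
    moreover have "?P 1 0 \<in> effdom f" "?P (a - 1) b \<in> effdom f"
      using ab True by (auto intro!: band simp: algebra_simps)
    moreover have "?P 1 0 + ?P (a - 1) b = y + y'"
      unfolding y' by (simp add: vec_eq_iff all_2_other[OF i'] P algebra_simps)
    \<comment> \<open>For a fixed sum, the total of the squared lengths is governed by the length of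
      the difference, whose components shrink from \<open>a\<close>, \<open>b\<close> to
      \<open>a - 2\<close>, \<open>b\<close> in absolute value.\<close>
    moreover have "sq_len (?P 1 0) + sq_len (?P (a - 1) b) < sq_len y + sq_len y'"
      unfolding y' sq P using s ab by (auto simp: power2_eq_square algebra_simps)
    ultimately show thesis
      using ab that[of "?P 1 0" "?P (a - 1) b"] between y y' by simp
  next
    case False
    then have [simp]: "b = a" using ab by simp
    have "?F 1 1 + ?F (a - 1) (a - 1) \<le> ?F 0 0 + ?F a a"
    proof (rule diagonal_telescope[where F = ?F and D = "\<lambda>k j. ?P k j \<in> effdom f"])
      show "2 * ?F (k + 1) (j + 1) \<le> ?F k j + ?F (k + 2) (j + 2)"
        if "?P k j \<in> effdom f" "?P (k + 2) (j + 2) \<in> effdom f" for k j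
        using real_ineq[OF that ineqs(3)[OF that]] by simp
    qed (use ab in \<open>auto intro!: band\<close>)
    moreover have "?P 1 1 \<in> effdom f" "?P (a - 1) (a - 1) \<in> effdom f"
      using ab by (auto intro!: band simp: algebra_simps)
    moreover have "?P 1 1 + ?P (a - 1) (a - 1) = y + y'"
      unfolding y' by (simp add: vec_eq_iff all_2_other[OF i'] P algebra_simps)
    moreover have "sq_len (?P 1 1) + sq_len (?P (a - 1) (a - 1)) < sq_len y + sq_len y'"
      unfolding y' sq P using s ab by (auto simp: power2_eq_square algebra_simps)
    ultimately show thesis
      using ab that[of "?P 1 1" "?P (a - 1) (a - 1)"] between y y' by simp
  qed
qed

section \<open>Localizing convex combinations\<close>

lemma finite_int_box: "finite {z :: int ^ 2. \<forall>m. \<bar>z $ m\<bar> \<le> M}"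
proof (rule finite_subset)
  show "{z :: int ^ 2. \<forall>m. \<bar>z $ m\<bar> \<le> M} \<subseteq> (\<lambda>(a, b). vector [a, b]) ` ({-M..M} \<times> {-M..M})"
  proof
    fix z :: "int ^ 2" assume "z \<in> {z. \<forall>m. \<bar>z $ m\<bar> \<le> M}"
    then have "(z $ 1, z $ 2) \<in> {-M..M} \<times> {-M..M}" by (auto simp: forall_2 abs_le_iff)
    moreover have "z = (\<lambda>(a, b). vector [a, b]) (z $ 1, z $ 2)"
      by (simp add: vec_eq_iff forall_2)
    ultimately show "z \<in> (\<lambda>(a, b). vector [a, b]) ` ({-M..M} \<times> {-M..M})" by blast
  qed
qed auto

lemma hull_graph_localize:
  fixes f :: "int ^ 2 \<Rightarrow> ereal"
  assumes f: "\<And>x. f x \<noteq> -\<infinity>"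
    and S: "integrally_convex_set (effdom f)"
    and five: "\<forall>z\<in>effdom f. five_ineqs (\<lambda>x1 x2. f (z + vector [x1, x2])) \<and>
      five_ineqs (\<lambda>x1 x2. f (z + vector [x2, x1]))"
    and mem: "(x, c) \<in> convex hull (graph_pt f ` effdom f)"
  obtains c' where "c' \<le> c" "(x, c') \<in> convex hull (graph_pt f ` (effdom f \<inter> int_nbhd x))"
proof -
  \<comment> \<open>Caratheodory's theorem supplies a finite support, which fits into a box of size
    \<open>M\<close>.\<close>
  obtain T where T: "finite T" "T \<subseteq> effdom f" "(x, c) \<in> convex hull (graph_pt f ` T)"
    using mem unfolding caratheodory[of "graph_pt f ` effdom f"]
    by (auto elim: finite_subset_image[THEN exE])
  define M where "M = Max (insert 0 ((\<lambda>(y, m). \<bar>y $ m\<bar>) ` (T \<times> UNIV)))"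
  have M: "\<bar>y $ m\<bar> \<le> M" if "y \<in> T" for y m
    unfolding M_def using that T(1) by (intro Max_ge) auto
  define B where "B = effdom f \<inter> {z. \<forall>m. \<bar>z $ m\<bar> \<le> M}"
  have B: "finite B" unfolding B_def using finite_int_box by blast
  define G where "G y = (graph_pt f y, real_of_int (sq_len y))" for y
  have inj: "inj_on G B" by (auto simp: inj_on_def G_def graph_pt_def)
  define K where "K = convex hull (G ` B)"
  \<comment> \<open>The combinations over \<open>x\<close> of cost at most \<open>c\<close>. The
    last component of \<open>G\<close> turns the mean of \<open>sq_len\<close> into a coordinate,
    which attains its minimum on this compact set.\<close>
  define A where "A = K \<inter> ({x} \<times> {..c}) \<times> UNIV"
  have cpt: "compact A" unfolding A_def K_def using B
    by (intro compact_Int_closed closed_Times finite_imp_compact_convex_hull) auto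
  have ne: "A \<noteq> {}"
  proof -
    have "fst ` K = convex hull (fst ` (G ` B))"
      unfolding K_def by (rule convex_hull_linear_image[OF linear_fst])
    also have "fst ` (G ` B) = graph_pt f ` B" by (simp add: image_image G_def)
    finally have "(x, c) \<in> fst ` K"
      using T(2) M by (auto intro!: subsetD[OF hull_mono T(3)] imageI simp: B_def)
    then show ?thesis by (auto simp: A_def)
  qed
  obtain p where p: "p \<in> A" and p_min: "\<And>q. q \<in> A \<Longrightarrow> snd p \<le> snd q"
    using continuous_attains_inf[OF cpt ne continuous_on_snd[OF continuous_on_id]] by auto
  obtain l where l: "\<And>y. y \<in> B \<Longrightarrow> 0 \<le> l y" "sum l B = 1" "(\<Sum>y\<in>B. l y *\<^sub>R G y) = p"
    using convex_hull_image_finiteE[OF _ B inj] p by (metis A_def IntD1 K_def)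
  have close: "\<bar>y $ m - y' $ m\<bar> \<le> 1"
    if y: "y \<in> B" "0 < l y" and y': "y' \<in> B" "0 < l y'" for y y' m
  proof (rule ccontr)
    assume "\<not> \<bar>y $ m - y' $ m\<bar> \<le> 1"
    then have far: "2 \<le> \<bar>y $ m - y' $ m\<bar>" by linarith
    then have neq: "y \<noteq> y'" by auto
    have ydom: "y \<in> effdom f" "y' \<in> effdom f" using y y' by (auto simp: B_def)
    obtain u v where u: "u \<in> effdom f" and v: "v \<in> effdom f" and uv: "u + v = y + y'"
      and u': "\<And>m. min (y $ m) (y' $ m) \<le> u $ m \<and> u $ m \<le> max (y $ m) (y' $ m)"
      and v': "\<And>m. min (y $ m) (y' $ m) \<le> v $ m \<and> v $ m \<le> max (y $ m) (y' $ m)"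
      and fuv: "real_of_ereal (f u) + real_of_ereal (f v) \<le> real_of_ereal (f y) + real_of_ereal (f y')"
      and sq: "sq_len u + sq_len v < sq_len y + sq_len y'"
      using exchange[where f = f, OF f S five ydom far] by blast
    have box: "\<bar>y $ m\<bar> \<le> M" "\<bar>y' $ m\<bar> \<le> M" for m using y y' by (auto simp: B_def)
    have "\<bar>u $ m\<bar> \<le> M" "\<bar>v $ m\<bar> \<le> M" for m
      using box[of m] u'[of m] v'[of m] by linarith+
    then have uB: "u \<in> B" and vB: "v \<in> B" using u v by (auto simp: B_def)
    define d where "d = min (l y) (l y')"
    have d: "0 < d" "d \<le> l y" "d \<le> l y'" using y y' by (auto simp: d_def)
    \<comment> \<open>Mass \<open>d\<close> moves from each of \<open>y\<close>, \<open>y'\<close>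
      to \<open>u\<close>, \<open>v\<close>. Adding indicators keeps the formula right when
      \<open>u = v\<close>; as \<open>y \<noteq> y'\<close>, neither of them loses more than
      \<open>d\<close>.\<close>
    define l' where "l' z = l z + d * (of_bool (z = u) + of_bool (z = v) - of_bool (z = y) - of_bool (z = y'))"
      for z
    have delta: "(\<Sum>z\<in>B. of_bool (z = w) *\<^sub>R h z) = h w" if "w \<in> B" for w and h :: "int ^ 2 \<Rightarrow> 'z::real_vector"
      using that B by (simp add: of_bool_def if_distrib[of "\<lambda>t. t *\<^sub>R _"] cong: if_cong)
    \<comment> \<open>Stated for arbitrary \<open>h\<close> to serve both the total mass, with
      \<open>h\<close> constantly 1, and the combination of the points \<open>G z\<close>.\<close>
    have sum_l': "(\<Sum>z\<in>B. l' z *\<^sub>R h z) = (\<Sum>z\<in>B. l z *\<^sub>R h z) + d *\<^sub>R (h u + h v - h y - h y')"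
      for h :: "int ^ 2 \<Rightarrow> 'z::real_vector"
    proof -
      have "(\<Sum>z\<in>B. l' z *\<^sub>R h z) = (\<Sum>z\<in>B. l z *\<^sub>R h z) + d *\<^sub>R
         ((\<Sum>z\<in>B. of_bool (z = u) *\<^sub>R h z) + (\<Sum>z\<in>B. of_bool (z = v) *\<^sub>R h z)
          - (\<Sum>z\<in>B. of_bool (z = y) *\<^sub>R h z) - (\<Sum>z\<in>B. of_bool (z = y') *\<^sub>R h z))"
        by (simp only: l'_def scaleR_add_left scaleR_diff_left scaleR_right.sum
            scaleR_right_distrib scaleR_right_diff_distrib distrib_left right_diff_distrib
            scaleR_scaleR sum.distrib sum_subtractf)
      then show ?thesis using uB vB y y' by (simp add: delta)
    qed
    have "0 \<le> l' z" if "z \<in> B" for z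
      using l(1)[OF that] d neq by (auto simp: l'_def of_bool_def algebra_simps)
    moreover have "sum l' B = 1"
      using sum_l'[of "\<lambda>_. 1 :: real"] l(2) by simp
    ultimately have q: "(\<Sum>z\<in>B. l' z *\<^sub>R G z) \<in> K"
      unfolding K_def using B by (intro sum_in_convex_hull_image) auto
    have qp: "(\<Sum>z\<in>B. l' z *\<^sub>R G z) = p + d *\<^sub>R (G u + G v - G y - G y')"
      by (simp add: sum_l' l(3))
    have "rvec u + rvec v = rvec y + rvec y'"
    proof -
      have "u $ m + v $ m = y $ m + y' $ m" for m using uv by (metis vector_add_component)
      then show ?thesis by (simp add: vec_eq_iff rvec_def flip: of_int_add)
    qed
    then have r: "rvec u + rvec v - rvec y - rvec y' = 0" by simp
    have "d * (real_of_ereal (f u) + real_of_ereal (f v) - real_of_ereal (f y) - real_of_ereal (f y')) \<le> 0"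
      using d fuv by (intro mult_nonneg_nonpos) auto
    \<comment> \<open>The move fixes \<open>x\<close> and does not raise the cost, so the new
      combination competes with the minimizer \<open>p\<close>.\<close>
    then have "p + d *\<^sub>R (G u + G v - G y - G y') \<in> A"
      using q p unfolding qp by (auto simp: A_def G_def graph_pt_def r mem_Times_iff)
    from p_min[OF this] have "0 \<le> d * (sq_len u + sq_len v - sq_len y - sq_len y')"
      by (simp add: G_def)
    then show False using d sq by (simp add: zero_le_mult_iff)
  qed
  have near: "y \<in> int_nbhd x" if y: "y \<in> B" "l y \<noteq> 0" for y
  proof -
    have ly: "0 < l y" using y l(1)[of y] by simp
    have x: "(\<Sum>z\<in>B. l z *\<^sub>R rvec z) = x"
      using arg_cong[OF l(3), of "fst \<circ> fst"] p by (auto simp: fst_sum G_def graph_pt_def A_def)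
    have "\<bar>x $ m - real_of_int (y $ m)\<bar> < 1" for m
    proof -
      have "x $ m - real_of_int (y $ m) = (\<Sum>z\<in>B. l z * (z $ m - y $ m))"
        using l(2)
        by (simp add: x[symmetric] rvec_def right_diff_distrib sum_subtractf
            flip: sum_distrib_right)
      also have "\<bar>\<dots>\<bar> \<le> (\<Sum>z\<in>B. \<bar>l z * (z $ m - y $ m)\<bar>)" by (rule sum_abs)
      \<comment> \<open>Support points differ from \<open>y\<close> by at most 1 in coordinate
        \<open>m\<close>, and \<open>y\<close> itself contributes 0; its positive mass makes the
        final bound \<open>1 - l y\<close> less than 1.\<close>
      also have "\<dots> \<le> (\<Sum>z\<in>B. l z * of_bool (z \<noteq> y))"
      proof (rule sum_mono)
        fix z assume z: "z \<in> B"
        show "\<bar>l z * (z $ m - y $ m)\<bar> \<le> l z * of_bool (z \<noteq> y)"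
        proof (cases "l z = 0 \<or> z = y")
          case False
          then have "0 < l z" using l(1)[OF z] by simp
          moreover from close[OF z this y(1) ly, of m] have "\<bar>real_of_int (z $ m - y $ m)\<bar> \<le> 1"
            by linarith
          ultimately show ?thesis using False by (simp add: abs_mult)
        qed auto
      qed
      also have "\<dots> = (\<Sum>z\<in>B. l z) - l y"
        using sum.remove[OF B y(1), of l] sum.remove[OF B y(1), of "\<lambda>z. l z * of_bool (z \<noteq> y)"]
        by simp
      finally show ?thesis using l(2) ly by simp
    qed
    then show ?thesis by (simp add: int_nbhd_def)
  qed
  have "fst p = (\<Sum>y\<in>B. l y *\<^sub>R graph_pt f y)"
    by (simp add: l(3)[symmetric] fst_sum G_def)
  also have "\<dots> \<in> convex hull (graph_pt f ` (effdom f \<inter> int_nbhd x))"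
    using l B near by (intro sum_in_convex_hull_image) (auto simp: B_def)
  finally show thesis
    using p that[of "snd (fst p)"] by (auto simp: A_def)
qed

section \<open>Sufficiency: convexity of the local extension\<close>

text \<open>The graph over a finite neighbourhood has a compact hull, so the costs are bounded
  below.\<close>

lemma local_convex_ext_not_MInf:
  fixes f :: "int ^ 'n \<Rightarrow> ereal"
  assumes f: "\<And>x. f x \<noteq> -\<infinity>"
  shows "local_convex_ext f x \<noteq> -\<infinity>"
proof
  assume inf: "local_convex_ext f x = -\<infinity>"
  let ?B = "effdom f \<inter> int_nbhd x"
  have "finite (graph_pt f ` ?B)" using finite_int_nbhd by blast
  then have "bounded (snd ` (convex hull (graph_pt f ` ?B)))"
    by (intro compact_imp_bounded compact_continuous_image continuous_intros
        finite_imp_compact_convex_hull)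
  then obtain b where b: "\<And>c. c \<in> snd ` (convex hull (graph_pt f ` ?B)) \<Longrightarrow> \<bar>c\<bar> \<le> b"
    unfolding bounded_iff by auto
  obtain c' where "ereal c' < ereal (- b)" "(x, c') \<in> convex hull (graph_pt f ` ?B)"
    using local_convex_ext_lessD[where f = f and x = x and c = "ereal (- b)", OF f] inf by auto
  then show False using b[of c'] by force
qed

text \<open>By \<open>loc\<close> the local extension lies below every point of the hull of the
  whole graph. Hull points within \<open>e\<close> of the values at \<open>x\<close> and
  \<open>y\<close> combine to a hull point over the intermediate argument, and \<open>e\<close> is
  arbitrary.\<close>

lemma ereal_convex_local_ext:
  fixes f :: "int ^ 'n \<Rightarrow> ereal"
  assumes f: "\<And>x. f x \<noteq> -\<infinity>"
    and loc: "\<And>x c. (x, c) \<in> convex hull (graph_pt f ` effdom f) \<Longrightarrow> local_convex_ext f x \<le> ereal c"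
  shows "ereal_convex (local_convex_ext f)"
  unfolding ereal_convex_def
proof (intro allI impI)
  fix x y :: "real ^ 'n" and u v :: real
  assume uv: "0 \<le> u" "0 \<le> v" "u + v = 1"
  let ?g = "local_convex_ext f"
  show "?g (u *\<^sub>R x + v *\<^sub>R y) \<le> ereal u * ?g x + ereal v * ?g y"
  \<comment> \<open>A zero weight cancels its term, even an infinite one; with positive weights an
    infinite value makes the right-hand side \<open>\<infinity>\<close>.\<close>
  proof (cases "u = 0 \<or> v = 0 \<or> ?g x = \<infinity> \<or> ?g y = \<infinity>")
    case True
    then show ?thesis using uv by (auto simp: zero_ereal_def[symmetric] one_ereal_def[symmetric])
  next
    case False
    then obtain X Y where XY: "?g x = ereal X" "?g y = ereal Y"
      using local_convex_ext_not_MInf[where f = f, OF f] by (metis ereal_cases)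
    have "?g (u *\<^sub>R x + v *\<^sub>R y) \<le> ereal (u * X + v * Y) + ereal e" if e: "0 < e" for e
    proof -
      have approx: "\<exists>c'<Z + e. (w, c') \<in> convex hull (graph_pt f ` effdom f)"
        if Z: "?g w = ereal Z" for w Z
      proof -
        have "?g w < ereal (Z + e)" using Z e by simp
        then obtain c' where "ereal c' < ereal (Z + e)"
            "(w, c') \<in> convex hull (graph_pt f ` (effdom f \<inter> int_nbhd w))"
          by (rule local_convex_ext_lessD[where f = f, OF f])
        moreover have "graph_pt f ` (effdom f \<inter> int_nbhd w) \<subseteq> graph_pt f ` effdom f" by blast
        ultimately show ?thesis using hull_mono by (metis less_ereal.simps(1) subsetD)
      qed
      obtain c1 where c1: "c1 < X + e" "(x, c1) \<in> convex hull (graph_pt f ` effdom f)"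
        using approx[OF XY(1)] by blast
      obtain c2 where c2: "c2 < Y + e" "(y, c2) \<in> convex hull (graph_pt f ` effdom f)"
        using approx[OF XY(2)] by blast
      have "u *\<^sub>R (x, c1) + v *\<^sub>R (y, c2) \<in> convex hull (graph_pt f ` effdom f)"
        using c1 c2 uv by (intro convexD) auto
      then have "?g (u *\<^sub>R x + v *\<^sub>R y) \<le> ereal (u * c1 + v * c2)"
        by (intro loc) simp
      also have "u * c1 + v * c2 \<le> u * (X + e) + v * (Y + e)"
        using c1 c2 uv by (intro add_mono mult_left_mono) auto
      also have "u * (X + e) + v * (Y + e) = u * X + v * Y + (u + v) * e" by (simp add: algebra_simps)
      finally show ?thesis using uv by simp
    qed
    then have "?g (u *\<^sub>R x + v *\<^sub>R y) \<le> ereal (u * X + v * Y)"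
      by (rule ereal_le_epsilon2)
    then show ?thesis by (simp add: XY)
  qed
qed

section \<open>Necessity: the effective domain and the midpoint inequalities\<close>

lemma local_convex_ext_rvec_le:
  fixes f :: "int ^ 'n \<Rightarrow> ereal"
  shows "local_convex_ext f (rvec z) \<le> f z"
proof -
  have "int_nbhd (rvec z) = {z}"
  proof -
    have "w = z" if "\<forall>i. \<bar>rvec z $ i - w $ i\<bar> < 1" for w
      unfolding vec_eq_iff
    proof
      fix i
      from that have "\<bar>real_of_int (z $ i) - real_of_int (w $ i)\<bar> < 1" by (simp add: rvec_def)
      then show "w $ i = z $ i" by linarith
    qed
    then show ?thesis by (auto simp: int_nbhd_def) (simp add: rvec_def)
  qed
  then show ?thesis
    unfolding local_convex_ext_def
    by (intro Inf_lower CollectI exI[of _ "\<lambda>_. 1"]) (auto simp: one_ereal_def[symmetric])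
qed

text \<open>The set where the local extension is finite is convex and contains the effective domain,
  hence its hull. A finite value at \<open>x\<close> yields a combination over the neighbourhood,
  whose projection represents \<open>x\<close>.\<close>

lemma integrally_convex_imp_effdom:
  fixes f :: "int ^ 'n \<Rightarrow> ereal"
  assumes f: "\<And>x. f x \<noteq> -\<infinity>" and ne: "effdom f \<noteq> {}" and cvx: "integrally_convex f"
  shows "integrally_convex_set (effdom f)"
  unfolding integrally_convex_set_def
proof (intro conjI ballI ne)
  fix x assume x: "x \<in> convex hull (rvec ` effdom f)"
  let ?g = "local_convex_ext f"
  have "convex {x. ?g x < \<infinity>}"
    unfolding convex_def
  proof (intro ballI allI impI CollectI)
    fix x y and u v :: real
    assume *: "x \<in> {x. ?g x < \<infinity>}" "y \<in> {x. ?g x < \<infinity>}" "0 \<le> u" "0 \<le> v" "u + v = 1"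
    then have "?g (u *\<^sub>R x + v *\<^sub>R y) \<le> ereal u * ?g x + ereal v * ?g y"
      using cvx by (auto simp: integrally_convex_def ereal_convex_def)
    also have "\<dots> < \<infinity>" using * by (cases "?g x"; cases "?g y") auto
    finally show "?g (u *\<^sub>R x + v *\<^sub>R y) < \<infinity>" .
  qed
  moreover have "rvec ` effdom f \<subseteq> {x. ?g x < \<infinity>}"
    by (auto simp only: effdom_def mem_Collect_eq intro: le_less_trans[OF local_convex_ext_rvec_le])
  ultimately have "?g x < \<infinity>" using x hull_minimal by blast
  then obtain c where "(x, c) \<in> convex hull (graph_pt f ` (effdom f \<inter> int_nbhd x))"
    using local_convex_ext_lessD[where f = f, OF f] by blast
  then have "x \<in> fst ` (convex hull (graph_pt f ` (effdom f \<inter> int_nbhd x)))" by force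
  also have "\<dots> = convex hull (fst ` (graph_pt f ` (effdom f \<inter> int_nbhd x)))"
    by (rule convex_hull_linear_image[OF linear_fst])
  finally show "x \<in> convex hull (rvec ` (effdom f \<inter> int_nbhd x))"
    by (simp add: image_image graph_pt_def)
qed

text \<open>The common midpoint \<open>x\<close> of both pairs has only \<open>p\<close> and
  \<open>q\<close> as integral neighbours, so the local extension at \<open>x\<close> is at least
  the mean of \<open>f p\<close> and \<open>f q\<close>; convexity bounds it by the mean of
  \<open>f y\<close> and \<open>f y'\<close>.\<close>

lemma integrally_convex_midpoint:
  fixes f :: "int ^ 'n \<Rightarrow> ereal"
  assumes cvx: "integrally_convex f"
    and sum: "y + y' = p + q" and near: "\<forall>m. m \<noteq> i \<longrightarrow> p $ m = q $ m" "\<bar>p $ i - q $ i\<bar> \<le> 1"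
  shows "f p + f q \<le> f y + f y'"
proof -
  let ?g = "local_convex_ext f"
  define x where "x = (1 / 2) *\<^sub>R rvec y + (1 / 2) *\<^sub>R rvec y'"
  have x: "x $ m = (real_of_int (p $ m) + real_of_int (q $ m)) / 2" for m
  proof -
    have "y $ m + y' $ m = p $ m + q $ m" using sum by (metis vector_add_component)
    then show ?thesis by (simp add: x_def rvec_def flip: of_int_add add_divide_distrib)
  qed
  have N: "int_nbhd x = {p, q}"
  proof -
    have "z = p \<or> z = q" if z: "z \<in> int_nbhd x" for z
    proof -
      have zm: "\<bar>(real_of_int (p $ m) + real_of_int (q $ m)) / 2 - z $ m\<bar> < 1" for m
        using z by (simp add: int_nbhd_def x)
      have "z $ m = p $ m" "z $ m = q $ m" if "m \<noteq> i" for m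
        using zm[of m] near(1) that by auto
      moreover have "z $ i = p $ i \<or> z $ i = q $ i"
      proof -
        have "real_of_int (p $ i + q $ i) < real_of_int (2 * z $ i + 2)"
          "real_of_int (2 * z $ i - 2) < real_of_int (p $ i + q $ i)"
          using zm[of i] unfolding abs_less_iff by (simp_all add: field_simps)
        then show ?thesis using near(2) unfolding of_int_less_iff by presburger
      qed
      ultimately show ?thesis unfolding vec_eq_iff by metis
    qed
    moreover have "p \<in> int_nbhd x" "q \<in> int_nbhd x"
      unfolding int_nbhd_def x mem_Collect_eq
    proof (safe)
      fix m
      have "\<bar>real_of_int (p $ m - q $ m)\<bar> \<le> 1" using near by (cases "m = i") auto
      then show "\<bar>(real_of_int (p $ m) + real_of_int (q $ m)) / 2 - real_of_int (p $ m)\<bar> < 1"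
        "\<bar>(real_of_int (p $ m) + real_of_int (q $ m)) / 2 - real_of_int (q $ m)\<bar> < 1"
        by auto
    qed
    ultimately show ?thesis by blast
  qed
  have "ereal (1 / 2) * f p + ereal (1 / 2) * f q \<le> ?g x"
    unfolding local_convex_ext_def N
  proof (rule Inf_greatest)
    fix t
    assume "t \<in> {(\<Sum>y\<in>{p, q}. ereal (l y) * f y) | l.
      (\<Sum>y\<in>{p, q}. l y *\<^sub>R rvec y) = x \<and> sum l {p, q} = 1 \<and> (\<forall>y\<in>{p, q}. 0 \<le> l y)}"
    then obtain l where lx: "(\<Sum>y\<in>{p, q}. l y *\<^sub>R rvec y) = x" and l1: "sum l {p, q} = 1"
      and t: "t = (\<Sum>y\<in>{p, q}. ereal (l y) * f y)"
      by blast
    show "ereal (1 / 2) * f p + ereal (1 / 2) * f q \<le> t"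
    proof (cases "p = q")
      case True
      then show ?thesis unfolding t using l1 by (cases "f q") (auto simp: one_ereal_def[symmetric])
    next
      case False
      then have pi: "p $ i \<noteq> q $ i" using near by (metis vec_eq_iff)
      have lq: "l q = 1 - l p" using l1 False by simp
      \<comment> \<open>Coordinate \<open>i\<close> separates \<open>p\<close> from
        \<open>q\<close>, so it pins both weights to \<open>1 / 2\<close>.\<close>
      have "l p * p $ i + l q * q $ i = (p $ i + q $ i) / 2"
        using arg_cong[OF lx, of "\<lambda>w. w $ i"] False by (simp add: x rvec_def)
      then have "(l p - 1 / 2) * (real_of_int (p $ i) - q $ i) = 0"
        unfolding lq by (simp add: field_simps)
      then have lp: "l p = 1 / 2" using pi by simp
      have "l q = 1 / 2" unfolding lq lp by simp
      then show ?thesis unfolding t using False lp by (simp del: eq_divide_eq_numeral1)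
    qed
  qed
  also have "\<dots> \<le> ereal (1 / 2) * ?g (rvec y) + ereal (1 / 2) * ?g (rvec y')"
    using cvx unfolding x_def integrally_convex_def ereal_convex_def by simp
  also have "\<dots> \<le> ereal (1 / 2) * f y + ereal (1 / 2) * f y'"
    by (intro add_mono ereal_mult_left_mono local_convex_ext_rvec_le) auto
  finally show ?thesis
    by (cases "f p"; cases "f q"; cases "f y"; cases "f y'") auto
qed

text \<open>In each inequality the two points on the smaller side coincide or differ by 1 in the
  second argument of \<open>g\<close>, which is coordinate 2 in the first form and coordinate 1 in
  the swapped one.\<close>

lemma integrally_convex_five_ineqs:
  fixes f :: "int ^ 2 \<Rightarrow> ereal"
  assumes "integrally_convex f"
  shows "five_ineqs (\<lambda>x1 x2. f (z + vector [x1, x2]))"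
    and "five_ineqs (\<lambda>x1 x2. f (z + vector [x2, x1]))"
proof -
  show "five_ineqs (\<lambda>x1 x2. f (z + vector [x1, x2]))"
    unfolding five_ineqs_def ereal_mult_2
    by (intro conjI integrally_convex_midpoint[OF assms, where i = 2])
       (simp_all add: vec_eq_iff forall_2)
  show "five_ineqs (\<lambda>x1 x2. f (z + vector [x2, x1]))"
    unfolding five_ineqs_def ereal_mult_2
    by (intro conjI integrally_convex_midpoint[OF assms, where i = 1])
       (simp_all add: vec_eq_iff forall_2)
qed

theorem theorem3p5:
  fixes f :: "int ^ 2 \<Rightarrow> ereal"
  assumes "\<And>x. f x \<noteq> -\<infinity>"
    and "effdom f \<noteq> {}"
  shows "integrally_convex f \<longleftrightarrow>
    integrally_convex_set (effdom f) \<and>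
    (\<forall>z \<in> effdom f.
       five_ineqs (\<lambda>x1 x2. f (z + vector [x1, x2])) \<and>
       five_ineqs (\<lambda>x1 x2. f (z + vector [x2, x1])))"
proof (intro iffI conjI ballI)
  assume "integrally_convex f"
  then show "integrally_convex_set (effdom f)"
    using integrally_convex_imp_effdom assms by blast
next
  fix z assume "integrally_convex f"
  then show "five_ineqs (\<lambda>x1 x2. f (z + vector [x1, x2]))"
    "five_ineqs (\<lambda>x1 x2. f (z + vector [x2, x1]))"
    by (fact integrally_convex_five_ineqs)+
next
  assume *: "integrally_convex_set (effdom f) \<and>
    (\<forall>z \<in> effdom f.
       five_ineqs (\<lambda>x1 x2. f (z + vector [x1, x2])) \<and>
       five_ineqs (\<lambda>x1 x2. f (z + vector [x2, x1])))"
  show "integrally_convex f"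
    unfolding integrally_convex_def
  proof (rule ereal_convex_local_ext[where f = f, OF assms(1)])
    fix x c assume "(x, c) \<in> convex hull (graph_pt f ` effdom f)"
    then obtain c' where "c' \<le> c" "(x, c') \<in> convex hull (graph_pt f ` (effdom f \<inter> int_nbhd x))"
      using hull_graph_localize[where f = f, OF assms(1)] * by blast
    then show "local_convex_ext f x \<le> ereal c"
      using local_convex_ext_le[where f = f, OF assms(1)] by (meson ereal_less_eq(3) order_trans)
  qed
qed

end
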